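(* Let $A\in\mathbb{R}^{m\times n}$ with $m\ll n$, let $k\ge 1$ be an integer (the sparsity level), let $\sigma_1$ and $\sigma_m$ be the largest and smallest singular values of $A$, and suppose that the restricted isometry constant of order $3k$ of $A$ satisfies $\delta_{3k}<\frac12$. Let $y:=Ax+e$ be the measurements of the signal $x\in\mathbb{R}^n$, where $e\in\mathbb{R}^m$ is the measurement error. Let $\epsilon$ be a given parameter satisfying $$\epsilon>\max\left\{\sigma_1^2,\ \left(\frac{\sigma_1^2-\sigma_m^2}{\frac12-\delta_{3k}}-1\right)\sigma_1^2\right\}.$$ If the stepsize $\lambda$ in the NSHTP algorithm is chosen such that $$\epsilon+\sigma_1^2-\left(\frac12-\delta_{3k}\right)\frac{\epsilon+\sigma_1^2}{\sigma_1^2}<\lambda\le\epsilon+\sigma_m^2,$$ then the sequence $\{x^p\}$ generated by NSHTP satisfies $$\|x^{p+1}-x_S\|_2\le\rho^p\|x^0-x_S\|_2+\tau\|Ax_{\overline S}+e\|_2,$$ where $$\rho=\frac{\sqrt3\left(\delta_{3k}+\sigma_1^2-\frac{\lambda\sigma_1^2}{\epsilon+\sigma_1^2}\right)}{\sqrt{1-(\delta_{2k})^2}}<1$$ and $$\tau=\frac{1}{1-\rho}\left(\frac{\sqrt3\,\lambda\sigma_1}{\sqrt{1-(\delta_{2k})^2}\,(\epsilon+\sigma_1^2)}+\frac{\sqrt{1+\delta_k}}{1-\delta_{2k}}\right).$$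
   Context: A vector is $q$-sparse if it has at most $q$ nonzero entries; $\mathrm{supp}(z)=\{i:z_i\ne0\}$. The singular values of $A\in\mathbb{R}^{m\times n}$ are written $\sigma_1\ge\sigma_2\ge\dots\ge\sigma_m$. Restricted isometry constant: for an integer $q$, $\delta_q$ is the smallest number $\delta_q\in(0,1]$ such that $(1-\delta_q)\|z\|_2^2\le\|Az\|_2^2\le(1+\delta_q)\|z\|_2^2$ for all $q$-sparse vectors $z\in\mathbb{R}^n$. An alternative expression is $\delta_q=\max_{T\subset\{1,\dots,n\},\,|T|\le q}\|A_T^TA_T-I\|_2$, where $A_T$ is the submatrix of columns of $A$ indexed by $T$ and $\|\cdot\|_2$ is the spectral norm. Hard thresholding operator: for $z\in\mathbb{R}^n$, $\mathcal{H}_k(z)$ is the vector obtained from $z$ by retaining the $k$ entries of largest magnitude and setting all other entries to $0$. For $x\in\mathbb{R}^n$, $x_S\in\mathbb{R}^n$ denotes the vector obtained from $x$ by retaining its $k$ largest magnitudes and zeroing out its other entries, with $S=\mathrm{supp}(\mathcal{H}_k(x))$, and $x_{\overline S}:=x-x_S\in\mathbb{R}^n$. NSHTP algorithm (Newton-step-based hard thresholding pursuit): with input the measurement matrix $A$, measurement vector $y$, sparsity level $k$, parameter $\epsilon>0$ and stepsize $\lambda$, and starting from an initial point $x^0$, it iterates for $p=0,1,2,\dots$ $$\overline{x}^{p}=\mathcal{H}_k\left(x^p+\lambda(A^TA+\epsilon I)^{-1}A^T(y-Ax^p)\right),$$ $$x^{p+1}=\arg\min_z\{\|y-Az\|_2^2:\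 \mathrm{supp}(z)\subseteq\mathrm{supp}(\overline{x}^p)\}.$$
   Formalization: The initial point x^0 is required to be k-sparse; for an arbitrary dense x^0 the stated bound already fails at p=0 (e.g. k=1 and A a union of 33 real mutually unbiased bases of R^64). *)

theory Defs
  imports "HOL-Analysis.Analysis"
begin

definition supp :: "real ^ 'n \<Rightarrow> 'n set" where
  "supp z = {i. z $ i \<noteq> 0}"

definition q_sparse :: "nat \<Rightarrow> real ^ 'n \<Rightarrow> bool" where
  "q_sparse q z \<longleftrightarrow> card (supp z) \<le> q"

definition restrict_vec :: "'n set \<Rightarrow> real ^ 'n \<Rightarrow> real ^ 'n" where
  "restrict_vec T z = (\<chi> i. if i \<in> T then z $ i else 0)"

text \<open>The \<open>m\<close> singular values of an \<open>m \<times> n\<close> matrix with \<open>m \<le> n\<close> are the square roots of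
  the eigenvalues of the \<open>m \<times> m\<close> matrix \<open>A A\<^sup>T\<close>. Multiplicities are irrelevant for the largest
  and smallest one, so they are collected in a set. (For \<open>m > n\<close> this set would contain
  superfluous zeros.)\<close>

definition is_eigenvalue :: "real ^ 'm ^ 'm \<Rightarrow> real \<Rightarrow> bool" where
  "is_eigenvalue M \<mu> \<longleftrightarrow> (\<exists>v. v \<noteq> 0 \<and> M *v v = \<mu> *\<^sub>R v)"

definition singular_values :: "real ^ 'n ^ 'm \<Rightarrow> real set" where
  "singular_values A = {sqrt \<mu> |\<mu>. is_eigenvalue (A ** transpose A) \<mu>}"

definition sigma_max :: "real ^ 'n ^ 'm \<Rightarrow> real" where
  "sigma_max A = Max (singular_values A)"

definition sigma_min :: "real ^ 'n ^ 'm \<Rightarrow> real" where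
  "sigma_min A = Min (singular_values A)"

definition RIP :: "real ^ 'n ^ 'm \<Rightarrow> nat \<Rightarrow> real \<Rightarrow> bool" where
  "RIP A q \<delta> \<longleftrightarrow> (\<forall>z. q_sparse q z \<longrightarrow>
     (1 - \<delta>) * (norm z)\<^sup>2 \<le> (norm (A *v z))\<^sup>2 \<and>
     (norm (A *v z))\<^sup>2 \<le> (1 + \<delta>) * (norm z)\<^sup>2)"

text \<open>The smallest admissible constant. Ranging over all \<open>\<delta> \<ge> 0\<close> rather than over \<open>(0, 1]\<close>
  makes the set nonempty for every matrix and lets the minimum be attained also when it is
  \<open>0\<close> (e.g. unit columns and \<open>q = 1\<close>), as in the expression
  \<open>max {\<parallel>A\<^sub>T\<^sup>T A\<^sub>T - I\<parallel> | card T \<le> q}\<close>; see the two lemmas below.\<close>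

definition ric :: "real ^ 'n ^ 'm \<Rightarrow> nat \<Rightarrow> real" where
  "ric A q = Inf {\<delta>. 0 \<le> \<delta> \<and> RIP A q \<delta>}"

lemma ric_is_least:
  shows "0 \<le> ric A q" and "RIP A q (ric A q)"
    and "\<lbrakk>0 \<le> \<delta>; RIP A q \<delta>\<rbrakk> \<Longrightarrow> ric A q \<le> \<delta>"
proof -
  let ?D = "{\<delta>. 0 \<le> \<delta> \<and> RIP A q \<delta>}"
  obtain B where B: "\<And>z. norm (A *v z) \<le> norm z * B"
    using bounded_linear.bounded[OF matrix_vector_mul_bounded_linear[of A]] by blast
  have sq: "(norm (A *v z))\<^sup>2 \<le> B\<^sup>2 * (norm z)\<^sup>2" for z
    using power_mono[OF B[of z], of 2] by (simp add: power_mult_distrib mult.commute)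
  have "RIP A q (1 + B\<^sup>2)"
    unfolding RIP_def
  proof (intro allI impI conjI)
    fix z
    show "(1 - (1 + B\<^sup>2)) * (norm z)\<^sup>2 \<le> (norm (A *v z))\<^sup>2"
      by (rule order_trans[of _ 0]) (simp_all add: mult_nonneg_nonneg)
    have "(1 + (1 + B\<^sup>2)) * (norm z)\<^sup>2 = B\<^sup>2 * (norm z)\<^sup>2 + 2 * (norm z)\<^sup>2"
      by (simp add: algebra_simps)
    then show "(norm (A *v z))\<^sup>2 \<le> (1 + (1 + B\<^sup>2)) * (norm z)\<^sup>2"
      using sq[of z] zero_le_power2[of "norm z"] by linarith
  qed
  then have ne: "?D \<noteq> {}" by (auto intro!: exI[of _ "1 + B\<^sup>2"])
  have bdd: "bdd_below ?D" by (rule bdd_belowI[of _ 0]) simp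
  show "0 \<le> ric A q" unfolding ric_def by (rule cInf_greatest[OF ne]) simp
  have "closed ?D"
    unfolding RIP_def Collect_conj_eq
    by (intro closed_Int closed_Collect_conj closed_Collect_le closed_Collect_all closed_Collect_imp
          open_Collect_const continuous_intros)
  then show "RIP A q (ric A q)"
    unfolding ric_def using closed_contains_Inf[OF ne bdd] by blast
  show "\<lbrakk>0 \<le> \<delta>; RIP A q \<delta>\<rbrakk> \<Longrightarrow> ric A q \<le> \<delta>"
    unfolding ric_def by (rule cInf_lower[OF _ bdd]) simp
qed

lemma ric_eqI:
  assumes "0 < \<delta>" "\<delta> \<le> 1" "RIP A q \<delta>"
    and "\<And>\<delta>'. \<lbrakk>0 < \<delta>'; \<delta>' \<le> 1; RIP A q \<delta>'\<rbrakk> \<Longrightarrow> \<delta> \<le> \<delta>'"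
  shows "ric A q = \<delta>"
proof (rule antisym)
  show le: "ric A q \<le> \<delta>" using assms ric_is_least(3)[of \<delta> A q] by simp
  show "\<delta> \<le> ric A q"
  proof (rule ccontr)
    assume "\<not> \<delta> \<le> ric A q"
    then obtain d where d: "ric A q < d" "d < \<delta>" using dense[of "ric A q" \<delta>] by auto
    have mono: "(1 - d) * t \<le> (1 - ric A q) * t" "(1 + ric A q) * t \<le> (1 + d) * t"
      if "0 \<le> t" for t
      using d(1) that by (auto intro!: mult_right_mono)
    have "RIP A q d"
      using ric_is_least(2)[of A q] mono unfolding RIP_def
      by (meson order_trans zero_le_power2)
    then show False
      using assms(2) assms(4)[of d] d ric_is_least(1)[of A q] by linarith
  qed
qed

text \<open>The \<open>k\<close> entries of largest magnitude need not be unique, so hard thresholding is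
  represented by the set of all possible outcomes.\<close>

definition hard_thresholds :: "nat \<Rightarrow> real ^ 'n \<Rightarrow> (real ^ 'n) set" where
  "hard_thresholds k z = {restrict_vec T z |T.
     card T = min k CARD('n) \<and> (\<forall>i\<in>T. \<forall>j\<in>-T. \<bar>z $ j\<bar> \<le> \<bar>z $ i\<bar>)}"

definition newton_step :: "real ^ 'n ^ 'm \<Rightarrow> real ^ 'm \<Rightarrow> real \<Rightarrow> real \<Rightarrow> real ^ 'n \<Rightarrow> real ^ 'n" where
  "newton_step A y \<epsilon> lam z =
     z + lam *\<^sub>R (matrix_inv (transpose A ** A + \<epsilon> *\<^sub>R mat 1) *v (transpose A *v (y - A *v z)))"

text \<open>The outcome of hard thresholding may be chosen arbitrarily in every iteration.\<close>

definition nshtp_sequence ::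
  "real ^ 'n ^ 'm \<Rightarrow> real ^ 'm \<Rightarrow> nat \<Rightarrow> real \<Rightarrow> real \<Rightarrow> (nat \<Rightarrow> real ^ 'n) \<Rightarrow> bool" where
  "nshtp_sequence A y k \<epsilon> lam xs \<longleftrightarrow>
     (\<forall>p. \<exists>xbar \<in> hard_thresholds k (newton_step A y \<epsilon> lam (xs p)).
        is_arg_min (\<lambda>z. (norm (y - A *v z))\<^sup>2) (\<lambda>z. supp z \<subseteq> supp xbar) (xs (Suc p)))"

end

theory Submission
  imports Defs
begin

text \<open>With \<open>h = x\<^sub>S\<close> and \<open>e' = Ax\<^bsub>S'\<^esub> + e\<close>, where \<open>S'\<close> is the complement of \<open>S\<close>, the
  Newton step has error \<open>(I - A\<^sup>TA) v + C v + lam b\<close> for \<open>v = x\<^sup>p - h\<close>. On the at most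
  \<open>3k\<close> relevant indices the first term contracts by \<open>\<delta>\<^bsub>3k\<^esub>\<close>; \<open>C\<close> is the function
  \<open>s - lam s / (\<epsilon> + s)\<close> of \<open>A\<^sup>TA\<close>, which on the spectrum lies between \<open>0\<close> and its value at
  \<open>\<sigma>\<^sub>1\<^sup>2\<close>. Hard thresholding loses at most a factor \<open>sqrt 2\<close>, because the entries of the
  intermediate vector discarded on the support of \<open>h\<close> are dominated by those kept off it. Orthogonality
  of the residual in the least squares step then bounds the new error by its part outside the new
  support.\<close>

declare transpose_matrix_vector [simp del]

section \<open>Positive semidefinite operators\<close>

text \<open>The form may be degenerate, so dividing by \<open>c\<close> needs a separate case for
  \<open>c = 0\<close>. Both cases test nonnegativity on one well chosen combination of
  \<open>x\<close> and \<open>y\<close>.\<close>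

lemma psd_cauchy_schwarz:
  fixes f :: "'a::real_inner \<Rightarrow> 'a"
  assumes lin: "linear f" and sym: "\<And>x y. x \<bullet> f y = f x \<bullet> y" and psd: "\<And>x. 0 \<le> x \<bullet> f x"
  shows "(x \<bullet> f y)\<^sup>2 \<le> (x \<bullet> f x) * (y \<bullet> f y)"
proof -
  define a b c where "a = x \<bullet> f x" and "b = x \<bullet> f y" and "c = y \<bullet> f y"
  have yx: "y \<bullet> f x = b"
    unfolding b_def using sym[of y x] by (simp add: inner_commute)
  have expand: "0 \<le> t\<^sup>2 * a + 2 * t * s * b + s\<^sup>2 * c" for t s
  proof -
    have "0 \<le> (t *\<^sub>R x + s *\<^sub>R y) \<bullet> f (t *\<^sub>R x + s *\<^sub>R y)" by (rule psd)
    also have "\<dots> = t\<^sup>2 * a + 2 * t * s * b + s\<^sup>2 * c"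
      by (simp add: linear_add[OF lin] linear_scale[OF lin] inner_add_left inner_add_right yx
          flip: a_def b_def c_def) (simp add: power2_eq_square algebra_simps)
    finally show ?thesis .
  qed
  have "0 \<le> a" "0 \<le> c" unfolding a_def c_def by (rule psd)+
  have "b\<^sup>2 \<le> a * c"
  proof (cases "c = 0")
    case True
    have "b = 0"
    proof (rule ccontr)
      assume "b \<noteq> 0"
      \<comment> \<open>For \<open>c = 0\<close> the form is affine in the coefficient of
        \<open>y\<close>; this coefficient makes its value -1.\<close>
      have "2 * (- (a + 1) / (2 * b)) * b = - (a + 1)" using \<open>b \<noteq> 0\<close> by simp
      with expand[of 1 "- (a + 1) / (2 * b)"] have "0 \<le> a + - (a + 1)" using True by simp
      then show False by simp
    qed
    then show ?thesis using True by simp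
  next
    case False
    \<comment> \<open>Up to scale, \<open>c\<close> for \<open>x\<close> and \<open>- b\<close> for
      \<open>y\<close> are the minimizing coefficients.\<close>
    have "0 \<le> c * (a * c - b\<^sup>2)"
      using expand[of c "- b"] by (simp add: power2_eq_square algebra_simps)
    then show ?thesis using False \<open>0 \<le> c\<close> by (simp add: zero_le_mult_iff)
  qed
  then show ?thesis unfolding a_def b_def c_def .
qed

text \<open>Cauchy-Schwarz for the form of \<open>f\<close>, taken at \<open>f x\<close> and
  \<open>x\<close>, bounds the fourth power of \<open>norm (f x)\<close> by its square times
  \<open>(c * norm x)\<^sup>2\<close>. This replaces diagonalization.\<close>

lemma psd_norm_le:
  fixes f :: "'a::real_inner \<Rightarrow> 'a"
  assumes lin: "linear f" and sym: "\<And>x y. x \<bullet> f y = f x \<bullet> y" and psd: "\<And>x. 0 \<le> x \<bullet> f x"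
    and le: "\<And>x. x \<bullet> f x \<le> c * (norm x)\<^sup>2" and "0 \<le> c"
  shows "norm (f x) \<le> c * norm x"
proof (cases "f x = 0")
  case True
  then show ?thesis using \<open>0 \<le> c\<close> by simp
next
  case False
  have "((norm (f x))\<^sup>2)\<^sup>2 = (f x \<bullet> f x)\<^sup>2" by (simp add: power2_norm_eq_inner)
  also have "\<dots> \<le> (f x \<bullet> f (f x)) * (x \<bullet> f x)" by (rule psd_cauchy_schwarz[OF lin sym psd])
  also have "\<dots> \<le> (c * (norm (f x))\<^sup>2) * (c * (norm x)\<^sup>2)"
    by (intro mult_mono le psd) (simp add: \<open>0 \<le> c\<close>)
  finally have "(norm (f x))\<^sup>2 * (norm (f x))\<^sup>2 \<le> (norm (f x))\<^sup>2 * (c * norm x)\<^sup>2"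
    by (simp add: power2_eq_square mult_ac)
  then have "(norm (f x))\<^sup>2 \<le> (c * norm x)\<^sup>2" by (rule mult_left_le_imp_le) (simp add: False)
  then show ?thesis by (rule power2_le_imp_le) (simp add: \<open>0 \<le> c\<close>)
qed

section \<open>Singular values and Rayleigh quotients\<close>

lemma inner_matrix_vector_transpose:
  fixes A :: "real ^ 'n ^ 'm"
  shows "x \<bullet> (A *v y) = (transpose A *v x) \<bullet> y"
  by (simp add: transpose_matrix_vector flip: dot_lmul_matrix)

text \<open>A maximizer \<open>v\<close> of the Rayleigh quotient exists by compactness of the
  sphere. The form of \<open>f\<close>, which is \<mu> I - N, is semidefinite and vanishes at
  \<open>v\<close>, so Cauchy-Schwarz forces \<open>f v = 0\<close>.\<close>

lemma symmetric_matrix_max_eigenvalue: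
  fixes N :: "real ^ 'm ^ 'm"
  assumes sym: "transpose N = N"
  obtains \<mu> where "is_eigenvalue N \<mu>" "\<And>w. w \<bullet> (N *v w) \<le> \<mu> * (norm w)\<^sup>2"
proof -
  have sph: "compact (sphere (0::real^'m) 1)" "sphere (0::real^'m) 1 \<noteq> {}" by auto
  have cont: "continuous_on (sphere 0 1) (\<lambda>v. v \<bullet> (N *v v))"
    by (intro continuous_intros linear_continuous_on matrix_vector_mul_bounded_linear)
  obtain v where v: "v \<in> sphere 0 1" and max: "\<And>w. w \<in> sphere 0 1 \<Longrightarrow> w \<bullet> (N *v w) \<le> v \<bullet> (N *v v)"
    using continuous_attains_sup[OF sph cont] by blast
  define \<mu> where "\<mu> = v \<bullet> (N *v v)"
  define f where "f = (\<lambda>w. \<mu> *\<^sub>R w - N *v w)"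
  have le: "w \<bullet> (N *v w) \<le> \<mu> * (norm w)\<^sup>2" for w
  proof (cases "w = 0")
    case False
    have "(inverse (norm w) *\<^sub>R w) \<bullet> (N *v (inverse (norm w) *\<^sub>R w)) \<le> \<mu>"
      unfolding \<mu>_def using False by (intro max) simp
    then show ?thesis
      using False by (simp add: matrix_vector_mult_scaleR power2_eq_square field_simps)
  qed simp
  have lin: "linear f"
    unfolding f_def
    by (auto intro!: linearI simp: algebra_simps)
  have fsym: "x \<bullet> f y = f x \<bullet> y" for x y
    unfolding f_def using inner_matrix_vector_transpose[of x N y] sym
    by (simp add: inner_diff_left inner_diff_right)
  have psd: "0 \<le> x \<bullet> f x" for x
    unfolding f_def using le[of x] by (simp add: inner_diff_right power2_norm_eq_inner)
  have "v \<bullet> f v = 0"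
    using v unfolding f_def by (simp add: inner_diff_right \<mu>_def flip: power2_norm_eq_inner)
  then have "(f v \<bullet> f v)\<^sup>2 \<le> 0" using psd_cauchy_schwarz[OF lin fsym psd, of "f v" v] by simp
  then have "f v = 0" by simp
  then have "is_eigenvalue N \<mu>"
    unfolding is_eigenvalue_def f_def using v by (intro exI[of _ v]) auto
  then show thesis using le that by blast
qed

lemma symmetric_matrix_min_eigenvalue:
  fixes N :: "real ^ 'm ^ 'm"
  assumes sym: "transpose N = N"
  obtains \<mu> where "is_eigenvalue N \<mu>" "\<And>w. \<mu> * (norm w)\<^sup>2 \<le> w \<bullet> (N *v w)"
proof -
  have neg: "(- N) *v w = - (N *v w)" for w
    by (simp add: matrix_vector_mult_def vec_eq_iff sum_negf)
  have "transpose (- N) = - N" using sym by (simp add: transpose_def vec_eq_iff)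
  then obtain \<mu> where ev: "is_eigenvalue (- N) \<mu>" and le: "\<And>w. w \<bullet> ((- N) *v w) \<le> \<mu> * (norm w)\<^sup>2"
    using symmetric_matrix_max_eigenvalue by blast
  have "is_eigenvalue N (- \<mu>)"
    using ev unfolding is_eigenvalue_def neg by (metis minus_minus scaleR_minus_left)
  moreover have "- \<mu> * (norm w)\<^sup>2 \<le> w \<bullet> (N *v w)" for w
    using le[of w] unfolding neg by simp
  ultimately show thesis by (rule that)
qed

text \<open>Eigenvectors of distinct eigenvalues are orthogonal and nonzero, so the dimension bounds
  their number. Finiteness makes the \<open>Max\<close> and \<open>Min\<close> over the singular
  values genuine extremes.\<close>

lemma finite_eigenvalues_symmetric:
  fixes N :: "real ^ 'm ^ 'm"
  assumes sym: "transpose N = N"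
  shows "finite {\<mu>. is_eigenvalue N \<mu>}"
proof -
  define E where "E = {\<mu>. is_eigenvalue N \<mu>}"
  have "\<forall>\<mu>\<in>E. \<exists>v. v \<noteq> 0 \<and> N *v v = \<mu> *\<^sub>R v"
    unfolding E_def is_eigenvalue_def by blast
  then obtain v where v: "\<And>\<mu>. \<mu> \<in> E \<Longrightarrow> v \<mu> \<noteq> 0 \<and> N *v v \<mu> = \<mu> *\<^sub>R v \<mu>"
    by metis
  have inj: "inj_on v E"
    by (rule inj_onI) (metis v scaleR_right_imp_eq)
  have orth: "v a \<bullet> v b = 0" if "a \<in> E" "b \<in> E" "a \<noteq> b" for a b
  proof -
    have "b * (v a \<bullet> v b) = a * (v a \<bullet> v b)"
      using inner_matrix_vector_transpose[of "v a" N "v b"] v[OF that(1)] v[OF that(2)] sym by simp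
    then show ?thesis using that by simp
  qed
  have "pairwise orthogonal (v ` E)"
    unfolding pairwise_def orthogonal_def using orth by auto
  then have "finite (v ` E)" by (rule pairwise_orthogonal_imp_finite)
  then show ?thesis using inj finite_imageD unfolding E_def by blast
qed

text \<open>The Rayleigh quotients of A A^T are bounded by its extreme eigenvalues, whose roots lie
  between \<open>sigma_min A\<close> and \<open>sigma_max A\<close>. The lower bound concerns
  \<open>transpose A\<close> only, since a matrix with more columns than rows has a kernel.\<close>

lemma
  fixes A :: "real ^ 'n ^ 'm"
  shows sigma_min_nonneg: "0 \<le> sigma_min A"
    and sigma_min_le_sigma_max: "sigma_min A \<le> sigma_max A"
    and norm_transpose_ge: "(sigma_min A)\<^sup>2 * (norm w)\<^sup>2 \<le> (norm (transpose A *v w))\<^sup>2"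
    and norm_transpose_le: "(norm (transpose A *v w))\<^sup>2 \<le> (sigma_max A)\<^sup>2 * (norm w)\<^sup>2"
proof -
  define N where "N = A ** transpose A"
  have sym: "transpose N = N" unfolding N_def by (simp add: matrix_transpose_mul)
  have N: "w \<bullet> (N *v w) = (norm (transpose A *v w))\<^sup>2" for w
    unfolding N_def
    by (simp add: inner_matrix_vector_transpose power2_norm_eq_inner flip: matrix_vector_mul_assoc)
  have pos: "0 \<le> \<mu>" if ev: "is_eigenvalue N \<mu>" for \<mu>
  proof -
    obtain v where v: "v \<noteq> 0" "N *v v = \<mu> *\<^sub>R v" using ev unfolding is_eigenvalue_def by auto
    have "0 \<le> v \<bullet> (N *v v)" unfolding N by simp
    then show ?thesis using v by (simp add: zero_le_mult_iff not_le flip: inner_gt_zero_iff)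
  qed
  have sv: "singular_values A = sqrt ` {\<mu>. is_eigenvalue N \<mu>}"
    unfolding singular_values_def N_def by (rule setcompr_eq_image)
  have fin: "finite (singular_values A)" unfolding sv using finite_eigenvalues_symmetric[OF sym] by simp
  obtain a where a: "is_eigenvalue N a" "\<And>w. w \<bullet> (N *v w) \<le> a * (norm w)\<^sup>2"
    using symmetric_matrix_max_eigenvalue[OF sym] by blast
  obtain b where b: "is_eigenvalue N b" "\<And>w. b * (norm w)\<^sup>2 \<le> w \<bullet> (N *v w)"
    using symmetric_matrix_min_eigenvalue[OF sym] by blast
  have ne: "singular_values A \<noteq> {}" unfolding sv using a by auto
  show 0: "0 \<le> sigma_min A"
    unfolding sigma_min_def using Min_in[OF fin ne] pos by (auto simp: sv)
  have sa: "sqrt a \<le> sigma_max A" unfolding sigma_max_def using a fin by (intro Max_ge) (auto simp: sv)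
  have sb: "sigma_min A \<le> sqrt b" unfolding sigma_min_def using b fin by (intro Min_le) (auto simp: sv)
  show "sigma_min A \<le> sigma_max A"
    unfolding sigma_min_def sigma_max_def by (rule Max_ge[OF fin Min_in[OF fin ne]])
  have "a \<le> (sigma_max A)\<^sup>2"
    using power_mono[OF sa, of 2] pos[OF a(1)] by simp
  then show "(norm (transpose A *v w))\<^sup>2 \<le> (sigma_max A)\<^sup>2 * (norm w)\<^sup>2"
    using order_trans[OF a(2)[of w] mult_right_mono] unfolding N by simp
  have "(sigma_min A)\<^sup>2 \<le> b"
    using power_mono[OF sb 0, of 2] pos[OF b(1)] by simp
  then show "(sigma_min A)\<^sup>2 * (norm w)\<^sup>2 \<le> (norm (transpose A *v w))\<^sup>2"
    using order_trans[OF mult_right_mono b(2)[of w]] unfolding N by simp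
qed

text \<open>The bound passes from the transpose to \<open>A\<close> by duality: the square of
  \<open>norm (A *v w)\<close> is the inner product of \<open>w\<close> with A^T A w, and one factor
  \<open>norm (A *v w)\<close> cancels.\<close>

lemma norm_matrix_vector_le_sigma_max:
  fixes A :: "real ^ 'n ^ 'm"
  shows "(norm (A *v w))\<^sup>2 \<le> (sigma_max A)\<^sup>2 * (norm w)\<^sup>2"
proof -
  have s: "0 \<le> sigma_max A" using sigma_min_nonneg[of A] sigma_min_le_sigma_max[of A] by linarith
  have "norm (transpose A *v (A *v w)) \<le> sigma_max A * norm (A *v w)"
    by (rule power2_le_imp_le) (use norm_transpose_le[of A "A *v w"] s in \<open>simp_all add: power_mult_distrib\<close>)
  then have "norm w * norm (transpose A *v (A *v w)) \<le> norm w * (sigma_max A * norm (A *v w))"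
    by (rule mult_left_mono) simp
  moreover have "(norm (A *v w))\<^sup>2 \<le> norm w * norm (transpose A *v (A *v w))"
    using norm_cauchy_schwarz[of "transpose A *v (A *v w)" w]
    by (simp add: power2_norm_eq_inner inner_matrix_vector_transpose mult.commute)
  ultimately have "norm (A *v w) * norm (A *v w) \<le> (sigma_max A * norm w) * norm (A *v w)"
    by (simp add: power2_eq_square mult_ac)
  then have "norm (A *v w) \<le> sigma_max A * norm w"
    using s by (cases "A *v w = 0") auto
  from power_mono[OF this norm_ge_zero, of 2] show ?thesis by (simp add: power_mult_distrib)
qed

section \<open>The regularized Newton step\<close>

abbreviation normal_inv :: "real ^ 'n ^ 'm \<Rightarrow> real \<Rightarrow> real ^ 'n ^ 'n" where
  "normal_inv A \<epsilon> \<equiv> matrix_inv (transpose A ** A + \<epsilon> *\<^sub>R mat 1)"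

text \<open>The regularized matrix \<open>K\<close> is positive definite because of the term in
  \<epsilon>, hence has trivial kernel and is invertible.\<close>

lemma
  fixes A :: "real ^ 'n ^ 'm"
  assumes "0 < \<epsilon>"
  shows normal_inv_left: "normal_inv A \<epsilon> *v (transpose A *v (A *v v) + \<epsilon> *\<^sub>R v) = v"
    and normal_inv_right: "transpose A *v (A *v (normal_inv A \<epsilon> *v v)) + \<epsilon> *\<^sub>R (normal_inv A \<epsilon> *v v) = v"
proof -
  define K where "K = transpose A ** A + \<epsilon> *\<^sub>R mat 1"
  have scal: "(\<epsilon> *\<^sub>R mat 1) *v w = \<epsilon> *\<^sub>R w" for w :: "real ^ 'n"
    by (metis matrix_vector_mul_lid scaleR_matrix_vector_assoc)
  have K: "K *v w = transpose A *v (A *v w) + \<epsilon> *\<^sub>R w" for w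
    unfolding K_def by (simp add: matrix_vector_mult_add_rdistrib scal flip: matrix_vector_mul_assoc)
  have "w = 0" if "K *v w = 0" for w
  proof -
    have "(norm (A *v w))\<^sup>2 + \<epsilon> * (norm w)\<^sup>2 = w \<bullet> (K *v w)"
      unfolding K power2_norm_eq_inner
      by (simp add: inner_add_right inner_matrix_vector_transpose)
    also have "\<dots> = 0" using that by simp
    finally have "\<epsilon> * (norm w)\<^sup>2 \<le> 0" using zero_le_power2[of "norm (A *v w)"] by linarith
    then show "w = 0" using assms by (simp add: mult_le_0_iff)
  qed
  then have "invertible K"
    unfolding invertible_left_inverse matrix_left_invertible_ker by blast
  then have "K ** matrix_inv K = mat 1 \<and> matrix_inv K ** K = mat 1"
    unfolding invertible_def matrix_inv_def by (rule someI_ex)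
  then have "matrix_inv K *v (K *v v) = v" "K *v (matrix_inv K *v v) = v"
    by (simp_all add: matrix_vector_mul_assoc)
  then show "normal_inv A \<epsilon> *v (transpose A *v (A *v v) + \<epsilon> *\<^sub>R v) = v"
    "transpose A *v (A *v (normal_inv A \<epsilon> *v v)) + \<epsilon> *\<^sub>R (normal_inv A \<epsilon> *v v) = v"
    unfolding K[symmetric] K_def[symmetric] .
qed

text \<open>The operator bounded here is \<open>\<phi>(A\<^sup>TA)\<close> for \<open>\<phi>(s) = s - lam s / (\<epsilon> + s)\<close>. After the
  substitution \<open>v = (A\<^sup>TA + \<epsilon>I) w\<close>, both \<open>0 \<le> \<phi>\<close> and \<open>\<phi> \<le> \<phi>(\<sigma>\<^sub>1\<^sup>2)\<close> become polynomial
  inequalities between the moments \<open>w \<bullet> (A\<^sup>TA)\<^sup>j w\<close>, so that no spectral decomposition is needed.\<close>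

lemma newton_remainder_norm_le:
  fixes A :: "real ^ 'n ^ 'm"
  assumes eps: "0 < \<epsilon>" and lam: "lam \<le> \<epsilon> + (sigma_min A)\<^sup>2"
  shows "norm (transpose A *v (A *v v) - lam *\<^sub>R (normal_inv A \<epsilon> *v (transpose A *v (A *v v))))
    \<le> ((sigma_max A)\<^sup>2 - lam * (sigma_max A)\<^sup>2 / (\<epsilon> + (sigma_max A)\<^sup>2)) * norm v"
proof -
  define s where "s = (sigma_max A)\<^sup>2"
  define B where "B = normal_inv A \<epsilon>"
  define M where "M = (\<lambda>v. transpose A *v (A *v v))"
  define K where "K = (\<lambda>v. M v + \<epsilon> *\<^sub>R v)"
  define f where "f = (\<lambda>v. M v - lam *\<^sub>R (B *v M v))"
  have BK: "B *v K w = w" and KB: "K (B *v w) = w" for w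
    unfolding B_def K_def M_def by (rule normal_inv_left[OF eps], rule normal_inv_right[OF eps])
  have Madd: "M (u + w) = M u + M w" and Mscale: "M (r *\<^sub>R u) = r *\<^sub>R M u" for u w r
    unfolding M_def by (simp_all add: matrix_vector_right_distrib matrix_vector_mult_scaleR)
  have MK: "M (K w) = K (M w)" for w unfolding K_def by (simp add: Madd Mscale)
  have Minner: "u \<bullet> M w = (A *v u) \<bullet> (A *v w)" for u w
    unfolding M_def by (simp add: inner_matrix_vector_transpose)
  have Msym: "u \<bullet> M w = M u \<bullet> w" for u w
    using Minner[of u w] Minner[of w u] by (simp add: inner_commute)
  have lin: "linear f"
    unfolding f_def
    by (rule linearI)
      (simp_all add: Madd Mscale matrix_vector_right_distrib matrix_vector_mult_scaleR algebra_simps)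
  \<comment> \<open>On vectors \<open>K w\<close> the inverse cancels, leaving a polynomial in
    \<open>M\<close>; by \<open>KB\<close> every vector has this form.\<close>
  have fK: "f (K w) = M (M w) + (\<epsilon> - lam) *\<^sub>R M w" for w
    unfolding f_def MK BK unfolding K_def by (simp add: algebra_simps)
  have form: "K u \<bullet> f (K w) = M u \<bullet> M (M w) + (2 * \<epsilon> - lam) * (M u \<bullet> M w) + \<epsilon> * (\<epsilon> - lam) * (u \<bullet> M w)"
    for u w
    unfolding fK using Msym[of u "M w"] unfolding K_def
    by (simp add: inner_add_left inner_add_right algebra_simps)
  have "K u \<bullet> f (K w) = f (K u) \<bullet> K w" for u w
    using form[of u w] form[of w u] Msym[of "M u" "M w"] Msym[of u w]
    by (simp add: inner_commute)
  then have fsym: "u \<bullet> f w = f u \<bullet> w" for u w by (metis KB)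
  have s: "(sigma_min A)\<^sup>2 \<le> s"
    unfolding s_def using sigma_min_le_sigma_max sigma_min_nonneg by (rule power_mono)
  have "0 \<le> s" unfolding s_def by simp
  define c where "c = s - lam * s / (\<epsilon> + s)"
  have c: "c = s * (\<epsilon> + s - lam) / (\<epsilon> + s)"
    unfolding c_def using eps \<open>0 \<le> s\<close> by (simp add: field_simps)
  have c0: "0 \<le> c" unfolding c using eps \<open>0 \<le> s\<close> s lam by simp
  have moments: "0 \<le> K w \<bullet> f (K w) \<and> K w \<bullet> f (K w) \<le> c * (norm (K w))\<^sup>2" for w
  proof -
    define a where "a = A *v w"
    define q0 q1 q2 q3 where "q0 = w \<bullet> w" and "q1 = w \<bullet> M w" and "q2 = M w \<bullet> M w" and "q3 = M w \<bullet> M (M w)"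
    have q1: "q1 = (norm a)\<^sup>2" unfolding q1_def Minner a_def by (simp add: power2_norm_eq_inner)
    have q2: "q2 = (norm (transpose A *v a))\<^sup>2" unfolding q2_def M_def a_def by (simp add: power2_norm_eq_inner)
    have q3: "q3 = (norm (A *v (transpose A *v a)))\<^sup>2"
      unfolding q3_def Minner unfolding a_def M_def by (simp add: power2_norm_eq_inner)
    have pos: "0 \<le> q0" "0 \<le> q1" "0 \<le> q2" "0 \<le> q3" unfolding q0_def q1 q2 q3 by simp_all
    have up: "q1 \<le> s * q0" "q2 \<le> s * q1" "q3 \<le> s * q2"
      using norm_matrix_vector_le_sigma_max[of A w] norm_transpose_le[of A a]
        norm_matrix_vector_le_sigma_max[of A "transpose A *v a"]
      unfolding q1 q2 q3 s_def q0_def a_def by (simp_all add: power2_norm_eq_inner)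
    \<comment> \<open>The smallest singular value controls \<open>transpose A\<close> only; it
      applies here because \<open>q1\<close> and \<open>q2\<close> are moments of
      \<open>a = A *v w\<close>, free of the kernel of \<open>A\<close>.\<close>
    have lo: "(lam - \<epsilon>) * q1 \<le> q2"
    proof -
      have "(lam - \<epsilon>) * q1 \<le> (sigma_min A)\<^sup>2 * q1" using lam pos by (intro mult_right_mono) auto
      then show ?thesis using norm_transpose_ge[of A a] unfolding q1 q2 by linarith
    qed
    \<comment> \<open>The bound moves up one moment by log-convexity,
      \<open>q2\<^sup>2 \<le> q1 * q3\<close>. If \<open>q1 = 0\<close>, then \<open>q2 = 0\<close>
      as well.\<close>
    have "q2 = a \<bullet> (A *v (transpose A *v a))"
      unfolding q2 by (simp add: inner_matrix_vector_transpose power2_norm_eq_inner)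
    then have "q2\<^sup>2 \<le> q1 * q3"
      using Cauchy_Schwarz_ineq[of a "A *v (transpose A *v a)"] unfolding q1 q3
      by (simp add: power2_norm_eq_inner)
    moreover have "q2 * ((lam - \<epsilon>) * q1) \<le> q2 * q2" using lo pos by (intro mult_left_mono)
    ultimately have "q1 * ((lam - \<epsilon>) * q2) \<le> q1 * q3" by (simp add: power2_eq_square mult_ac)
    then have lo3: "(lam - \<epsilon>) * q2 \<le> q3"
      using pos up(2) by (cases "q1 = 0") (auto simp: mult_le_cancel_left)
    have Kf: "K w \<bullet> f (K w) = q3 + (2 * \<epsilon> - lam) * q2 + \<epsilon> * (\<epsilon> - lam) * q1"
      unfolding form q1_def q2_def q3_def ..
    have KK: "(norm (K w))\<^sup>2 = q2 + 2 * \<epsilon> * q1 + \<epsilon>\<^sup>2 * q0"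
      unfolding power2_norm_eq_inner K_def q0_def q1_def q2_def
      by (simp add: inner_add_left inner_add_right inner_commute power2_eq_square algebra_simps)
    have "0 \<le> (q3 - (lam - \<epsilon>) * q2) + \<epsilon> * (q2 - (lam - \<epsilon>) * q1)" using lo lo3 eps by simp
    then have "0 \<le> K w \<bullet> f (K w)" unfolding Kf by (simp add: algebra_simps)
    moreover have "K w \<bullet> f (K w) \<le> c * (norm (K w))\<^sup>2"
    proof -
      \<comment> \<open>For a point t of the spectrum, c (t + \<epsilon>) - t (t + \<epsilon> - lam)
        has the root s, and its other root is -b, so it equals (s - t) (t + b). Multiplying by t +
        \<epsilon> and passing to moments gives the sum below.\<close>
      define b where "b = \<epsilon> * (\<epsilon> + s - lam) / (\<epsilon> + s)"
      have nz: "\<epsilon> + s \<noteq> 0" using eps \<open>0 \<le> s\<close> by linarith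
      have "0 \<le> b" unfolding b_def using eps s lam \<open>0 \<le> s\<close> by simp
      then have "0 \<le> (s * q2 - q3) + (b + \<epsilon>) * (s * q1 - q2) + b * \<epsilon> * (s * q0 - q1)"
        using up eps by simp
      also have "\<dots> = c * (norm (K w))\<^sup>2 - K w \<bullet> f (K w)"
      proof -
        \<comment> \<open>Replacing \<open>lam\<close> by \<open>g\<close> makes the identity
          polynomial, without divisions.\<close>
        define g where "g = (\<epsilon> + s - lam) / (\<epsilon> + s)"
        have lamg: "lam = (\<epsilon> + s) * (1 - g)" unfolding g_def using nz by (simp add: field_simps)
        have "c = s * g" "b = \<epsilon> * g" unfolding c b_def g_def by simp_all
        then show ?thesis unfolding KK Kf lamg by (simp add: power2_eq_square algebra_simps)
      qed
      finally show ?thesis by simp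
    qed
    ultimately show ?thesis ..
  qed
  have psd: "0 \<le> u \<bullet> f u" and le: "u \<bullet> f u \<le> c * (norm u)\<^sup>2" for u
    using moments[of "B *v u"] unfolding KB by auto
  have "norm (f v) \<le> c * norm v" by (rule psd_norm_le[OF lin fsym psd le c0])
  then show ?thesis unfolding f_def c_def s_def M_def B_def .
qed

text \<open>The inverse is pushed through the transpose: (A^T A + \<epsilon> I)^-1 A^T = A^T (A A^T
  + \<epsilon> I)^-1. On a singular value t this acts as t / (\<epsilon> + t^2), which increases as
  long as t^2 is at most \<epsilon>.\<close>

lemma normal_inv_transpose_norm_le:
  fixes A :: "real ^ 'n ^ 'm"
  assumes eps: "0 < \<epsilon>" "(sigma_max A)\<^sup>2 \<le> \<epsilon>"
  shows "norm (normal_inv A \<epsilon> *v (transpose A *v e)) \<le> sigma_max A / (\<epsilon> + (sigma_max A)\<^sup>2) * norm e"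
proof -
  define s where "s = (sigma_max A)\<^sup>2"
  have s0: "0 \<le> sigma_max A" using sigma_min_nonneg[of A] sigma_min_le_sigma_max[of A] by linarith
  have s: "0 \<le> s" "s \<le> \<epsilon>" unfolding s_def using eps by simp_all
  define w where "w = normal_inv (transpose A) \<epsilon> *v e"
  have e: "e = A *v (transpose A *v w) + \<epsilon> *\<^sub>R w"
    unfolding w_def using normal_inv_right[OF eps(1), of "transpose A" e]
    by (simp add:)
  have "transpose A *v e = transpose A *v (A *v (transpose A *v w)) + \<epsilon> *\<^sub>R (transpose A *v w)"
    unfolding e by (simp add: matrix_vector_right_distrib matrix_vector_mult_scaleR)
  then have lhs: "normal_inv A \<epsilon> *v (transpose A *v e) = transpose A *v w"
    by (simp add: normal_inv_left[OF eps(1)])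
  define q0 q1 q2 where "q0 = (norm w)\<^sup>2" and "q1 = (norm (transpose A *v w))\<^sup>2"
    and "q2 = (norm (A *v (transpose A *v w)))\<^sup>2"
  have up: "q1 \<le> s * q0" unfolding q0_def q1_def s_def by (rule norm_transpose_le)
  have wN: "w \<bullet> (A *v (transpose A *v w)) = q1"
    unfolding q1_def by (simp add: inner_matrix_vector_transpose power2_norm_eq_inner)
  have ee: "(norm e)\<^sup>2 = q2 + 2 * \<epsilon> * q1 + \<epsilon>\<^sup>2 * q0"
    unfolding e power2_norm_eq_inner q0_def q2_def using wN
    by (simp add: inner_add_left inner_add_right inner_commute power2_eq_square algebra_simps)
  \<comment> \<open>For t in the spectrum of A A^T, s (t + \<epsilon>)^2 - (\<epsilon> + s)^2 t = s
    (t - s)^2 + (\<epsilon>^2 - s^2) (s - t). This norm supplies the square (t - s)^2.\<close>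
  have "0 \<le> (norm (A *v (transpose A *v w) - s *\<^sub>R w))\<^sup>2" by simp
  also have "\<dots> = q2 - 2 * s * q1 + s\<^sup>2 * q0"
    unfolding power2_norm_eq_inner q0_def q2_def using wN
    by (simp add: inner_diff_left inner_diff_right inner_commute power2_eq_square algebra_simps)
  finally have sq: "0 \<le> q2 - 2 * s * q1 + s\<^sup>2 * q0" .
  have "s\<^sup>2 \<le> \<epsilon>\<^sup>2" using s by (intro power_mono)
  then have "0 \<le> (\<epsilon>\<^sup>2 - s\<^sup>2) * (s * q0 - q1)" using up by simp
  then have "0 \<le> s * (q2 - 2 * s * q1 + s\<^sup>2 * q0) + (\<epsilon>\<^sup>2 - s\<^sup>2) * (s * q0 - q1)"
    using mult_nonneg_nonneg[OF s(1) sq] by linarith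
  also have "\<dots> = s * (norm e)\<^sup>2 - (\<epsilon> + s)\<^sup>2 * q1"
    unfolding ee by (simp add: power2_eq_square algebra_simps)
  finally have "((\<epsilon> + s) * norm (transpose A *v w))\<^sup>2 \<le> (sigma_max A * norm e)\<^sup>2"
    unfolding q1_def s_def by (simp add: power_mult_distrib)
  then have "(\<epsilon> + s) * norm (transpose A *v w) \<le> sigma_max A * norm e"
    by (rule power2_le_imp_le) (simp add: s0)
  then show ?thesis unfolding lhs s_def[symmetric] using eps s by (simp add: field_simps)
qed

section \<open>Restricted isometry\<close>

lemma supp_restrict_vec: "supp (restrict_vec T z) = T \<inter> supp z"
  unfolding supp_def restrict_vec_def by auto

lemma norm_restrict_vec: "(norm (restrict_vec T z))\<^sup>2 = (\<Sum>i\<in>T. (z $ i)\<^sup>2)"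
proof -
  have "(norm (restrict_vec T z))\<^sup>2 = (\<Sum>i\<in>UNIV. if i \<in> T then (z $ i)\<^sup>2 else 0)"
    unfolding power2_norm_eq_inner inner_vec_def restrict_vec_def
    by (intro sum.cong) (auto simp: power2_eq_square)
  then show ?thesis by (simp add: sum.If_cases)
qed

lemma inner_restrict_vec: "z \<bullet> restrict_vec T z = (norm (restrict_vec T z))\<^sup>2"
  unfolding power2_norm_eq_inner inner_vec_def restrict_vec_def by (intro sum.cong) auto

text \<open>Polarization: all combinations of \<open>v\<close> and \<open>w\<close> are still
  \<open>q\<close>-sparse. Scaling each vector by the norm of the other equalizes the lengths, so
  the parallelogram law yields exactly the product of the norms.\<close>

lemma RIP_inner_le:
  assumes rip: "RIP A q \<delta>" and card: "card (supp v \<union> supp w) \<le> q"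
  shows "\<bar>v \<bullet> w - (A *v v) \<bullet> (A *v w)\<bar> \<le> \<delta> * norm v * norm w"
proof (cases "v = 0 \<or> w = 0")
  case False
  define Q where "Q = (\<lambda>z. (norm z)\<^sup>2 - (norm (A *v z))\<^sup>2)"
  have Q: "\<bar>Q (a *\<^sub>R v + b *\<^sub>R w)\<bar> \<le> \<delta> * (norm (a *\<^sub>R v + b *\<^sub>R w))\<^sup>2" for a b
  proof -
    have "supp (a *\<^sub>R v + b *\<^sub>R w) \<subseteq> supp v \<union> supp w" unfolding supp_def by auto
    then have "card (supp (a *\<^sub>R v + b *\<^sub>R w)) \<le> card (supp v \<union> supp w)"
      by (intro card_mono) auto
    then have "q_sparse q (a *\<^sub>R v + b *\<^sub>R w)" unfolding q_sparse_def using card by simp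
    then show ?thesis using rip unfolding RIP_def Q_def by (fastforce simp: algebra_simps abs_le_iff)
  qed
  define n1 n2 where "n1 = norm v" and "n2 = norm w"
  have sq: "v \<bullet> v = n1\<^sup>2" "w \<bullet> w = n2\<^sup>2" unfolding n1_def n2_def by (simp_all add: power2_norm_eq_inner)
  have pos: "0 < n1 * n2" and nonneg: "0 \<le> n1" "0 \<le> n2" using False unfolding n1_def n2_def by simp_all
  let ?g = "v \<bullet> w - (A *v v) \<bullet> (A *v w)"
  have "Q (n2 *\<^sub>R v + n1 *\<^sub>R w) - Q (n2 *\<^sub>R v + (- n1) *\<^sub>R w) = 4 * (n1 * n2) * ?g"
    unfolding Q_def power2_norm_eq_inner matrix_vector_right_distrib matrix_vector_mult_scaleR
    by (simp add: inner_add_left inner_add_right inner_commute algebra_simps)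
  then have "4 * (n1 * n2) * \<bar>?g\<bar> = \<bar>Q (n2 *\<^sub>R v + n1 *\<^sub>R w) - Q (n2 *\<^sub>R v + (- n1) *\<^sub>R w)\<bar>"
    by (simp add: abs_mult nonneg)
  also have "\<dots> \<le> \<delta> * ((norm (n2 *\<^sub>R v + n1 *\<^sub>R w))\<^sup>2 + (norm (n2 *\<^sub>R v + (- n1) *\<^sub>R w))\<^sup>2)"
    using Q[of n2 n1] Q[of n2 "- n1"] unfolding distrib_left by linarith
  also have "(norm (n2 *\<^sub>R v + n1 *\<^sub>R w))\<^sup>2 + (norm (n2 *\<^sub>R v + (- n1) *\<^sub>R w))\<^sup>2 = 4 * (n1 * n2) * (n1 * n2)"
    unfolding power2_norm_eq_inner
    by (simp add: inner_add_left inner_add_right inner_diff_left inner_diff_right inner_commute sq)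
      (simp add: power2_eq_square algebra_simps)
  finally have "(4 * (n1 * n2)) * \<bar>?g\<bar> \<le> (4 * (n1 * n2)) * (\<delta> * (n1 * n2))"
    by (simp add: mult_ac)
  then have "\<bar>?g\<bar> \<le> \<delta> * (n1 * n2)" by (rule mult_left_le_imp_le) (use pos in simp)
  then show ?thesis unfolding n1_def n2_def by (simp add: mult_ac)
qed auto

lemma ric_mono:
  assumes "p \<le> q"
  shows "ric A p \<le> ric A q"
proof (rule ric_is_least(3)[OF ric_is_least(1)])
  have "q_sparse q z" if "q_sparse p z" for z
    using that assms unfolding q_sparse_def by simp
  then show "RIP A p (ric A q)" using ric_is_least(2)[of A q] unfolding RIP_def by blast
qed

text \<open>A coordinate vector is 1-sparse. With a constant below 1/2 this keeps the squared
  largest singular value above 1/2, which makes the lower stepsize bound positive.\<close>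

lemma sigma_max_ge_ric:
  fixes A :: "real ^ 'n ^ 'm"
  assumes "1 \<le> q"
  shows "1 - ric A q \<le> (sigma_max A)\<^sup>2"
proof -
  define z :: "real ^ 'n" where "z = axis undefined 1"
  have "supp z = {undefined}" unfolding supp_def z_def axis_def by auto
  then have "q_sparse q z" unfolding q_sparse_def using assms by simp
  moreover have "norm z = 1" unfolding z_def by simp
  ultimately show ?thesis
    using ric_is_least(2)[of A q] norm_matrix_vector_le_sigma_max[of A z] unfolding RIP_def by fastforce
qed

section \<open>Hard thresholding and pursuit\<close>

lemma card_supp_hard_thresholds:
  assumes "xbar \<in> hard_thresholds k u"
  shows "card (supp xbar) \<le> k"
proof -
  obtain T where T: "xbar = restrict_vec T u" "card T = min k CARD('a)"
    using assms unfolding hard_thresholds_def by blast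
  have "card (supp xbar) \<le> card T"
    unfolding T(1) supp_restrict_vec by (intro card_mono) auto
  then show ?thesis using T(2) by simp
qed

text \<open>An exchange argument: \<open>T\<close> is at least as large as \<open>S\<close>, so
  \<open>T - S\<close> has at least as many entries as \<open>S - T\<close>, and each of them
  dominates.\<close>

lemma sum_squares_hard_thresholds_le:
  fixes u :: "real ^ 'n"
  assumes ht: "xbar \<in> hard_thresholds k u" and S: "card S \<le> k"
  shows "(\<Sum>i\<in>S - supp xbar. (u $ i)\<^sup>2) \<le> (\<Sum>i\<in>supp xbar - S. (u $ i)\<^sup>2)"
proof -
  obtain T where xbar: "xbar = restrict_vec T u" and cT: "card T = min k CARD('n)"
    and T: "\<And>i j. i \<in> T \<Longrightarrow> j \<notin> T \<Longrightarrow> \<bar>u $ j\<bar> \<le> \<bar>u $ i\<bar>"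
    using ht unfolding hard_thresholds_def by blast
  have supp: "supp xbar = {i \<in> T. u $ i \<noteq> 0}"
    unfolding xbar supp_restrict_vec by (auto simp: supp_def)
  show ?thesis
  proof (cases "supp xbar = T \<and> S - T \<noteq> {}")
    case True
    define b where "b = Max ((\<lambda>j. (u $ j)\<^sup>2) ` (S - T))"
    have fin: "finite ((\<lambda>j. (u $ j)\<^sup>2) ` (S - T))" by simp
    have "b \<in> (\<lambda>j. (u $ j)\<^sup>2) ` (S - T)" unfolding b_def using True by (intro Max_in) auto
    then obtain j where j: "j \<in> S - T" "b = (u $ j)\<^sup>2" by blast
    have "card S \<le> card T" using S card_mono[of UNIV S] cT by simp
    then have "card (S - T) \<le> card (T - S)"
      using card_Diff_subset_Int[of S T] card_Diff_subset_Int[of T S] by (simp add: Int_commute)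
    have "(\<Sum>i\<in>S - T. (u $ i)\<^sup>2) \<le> real (card (S - T)) * b"
      by (rule sum_bounded_above) (simp add: b_def fin)
    also have "\<dots> \<le> real (card (T - S)) * b"
      using \<open>card (S - T) \<le> card (T - S)\<close> j by (intro mult_right_mono) auto
    also have "\<dots> \<le> (\<Sum>i\<in>T - S. (u $ i)\<^sup>2)"
      by (rule sum_bounded_below) (use j T in \<open>auto simp: abs_le_square_iff\<close>)
    finally show ?thesis using True by simp
  next
    \<comment> \<open>Either a retained entry is zero, and then so are all discarded ones, or
      \<open>S\<close> lies in \<open>T\<close>; both ways \<open>u\<close> vanishes on
      \<open>S - supp xbar\<close>.\<close>
    case False
    then have "u $ i = 0" if "i \<in> S - supp xbar" for i
      using that T unfolding supp by fastforce
    then have "(\<Sum>i\<in>S - supp xbar. (u $ i)\<^sup>2) = 0" by simp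
    then show ?thesis by (simp add: sum_nonneg)
  qed
qed

lemma norm_outside_hard_thresholds_le:
  assumes ht: "xbar \<in> hard_thresholds k u" and h: "card (supp h) \<le> k"
  shows "norm (restrict_vec (- supp xbar) h)
    \<le> sqrt 2 * norm (restrict_vec (supp h \<union> supp xbar) (u - h))"
proof -
  define S where "S = supp h"
  define W where "W = supp xbar"
  have "(norm (restrict_vec (- W) h))\<^sup>2 = (\<Sum>i\<in>S - W. (h $ i)\<^sup>2)"
    unfolding norm_restrict_vec by (rule sum.mono_neutral_right) (auto simp: S_def supp_def)
  also have "\<dots> \<le> (\<Sum>i\<in>S - W. 2 * ((u - h) $ i)\<^sup>2 + 2 * (u $ i)\<^sup>2)"
  proof (rule sum_mono)
    fix i
    have "0 \<le> (2 * u $ i - h $ i)\<^sup>2" by simp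
    then show "(h $ i)\<^sup>2 \<le> 2 * ((u - h) $ i)\<^sup>2 + 2 * (u $ i)\<^sup>2"
      by (simp add: power2_eq_square algebra_simps)
  qed
  also have "\<dots> = 2 * (\<Sum>i\<in>S - W. ((u - h) $ i)\<^sup>2) + 2 * (\<Sum>i\<in>S - W. (u $ i)\<^sup>2)"
    by (simp add: sum.distrib sum_distrib_left)
  also have "\<dots> \<le> 2 * (\<Sum>i\<in>S - W. ((u - h) $ i)\<^sup>2) + 2 * (\<Sum>i\<in>W - S. (u $ i)\<^sup>2)"
    using sum_squares_hard_thresholds_le[OF ht h] unfolding W_def S_def by simp
  \<comment> \<open>Off the support of \<open>h\<close> the entries of \<open>u\<close> are
    themselves errors, and they sit on indices disjoint from \<open>S - W\<close>, so the factor
    stays 2.\<close>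
  also have "(\<Sum>i\<in>W - S. (u $ i)\<^sup>2) = (\<Sum>i\<in>W - S. ((u - h) $ i)\<^sup>2)"
    by (rule sum.cong) (auto simp: S_def supp_def)
  also have "2 * (\<Sum>i\<in>S - W. ((u - h) $ i)\<^sup>2) + 2 * (\<Sum>i\<in>W - S. ((u - h) $ i)\<^sup>2)
      = 2 * (\<Sum>i\<in>(S - W) \<union> (W - S). ((u - h) $ i)\<^sup>2)"
    by (subst sum.union_disjoint) auto
  also have "\<dots> \<le> 2 * (\<Sum>i\<in>S \<union> W. ((u - h) $ i)\<^sup>2)"
    by (intro mult_left_mono sum_mono2) auto
  also have "\<dots> = (sqrt 2 * norm (restrict_vec (S \<union> W) (u - h)))\<^sup>2"
    by (simp add: power_mult_distrib norm_restrict_vec)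
  finally show ?thesis unfolding S_def W_def
    by (rule power2_le_imp_le) (intro mult_nonneg_nonneg; simp)
qed

section \<open>Least squares on a fixed support\<close>

lemma arg_min_residual_orthogonal:
  assumes min: "is_arg_min (\<lambda>z. (norm (y - A *v z))\<^sup>2) (\<lambda>z. supp z \<subseteq> W) x"
    and z: "supp z \<subseteq> W"
  shows "(y - A *v x) \<bullet> (A *v z) = 0"
proof (rule ccontr)
  define r w where "r = y - A *v x" and "w = A *v z"
  assume "(y - A *v x) \<bullet> (A *v z) \<noteq> 0"
  then have nz: "r \<bullet> w \<noteq> 0" "w \<bullet> w \<noteq> 0" unfolding r_def w_def by auto
  \<comment> \<open>This is the exact minimizer along \<open>z\<close>; it would lower the squared
    residual by \<open>(r \<bullet> w)\<^sup>2 / (w \<bullet> w)\<close>.\<close>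
  define t where "t = (r \<bullet> w) / (w \<bullet> w)"
  have "supp x \<subseteq> W" using min unfolding is_arg_min_def by blast
  then have "supp (x + t *\<^sub>R z) \<subseteq> W" using z unfolding supp_def subset_iff by force
  then have "(norm r)\<^sup>2 \<le> (norm (y - A *v (x + t *\<^sub>R z)))\<^sup>2"
    using min unfolding is_arg_min_def r_def by (meson not_le)
  also have "y - A *v (x + t *\<^sub>R z) = r - t *\<^sub>R w"
    unfolding r_def w_def by (simp add: matrix_vector_right_distrib matrix_vector_mult_scaleR)
  also have "(norm (r - t *\<^sub>R w))\<^sup>2 = (norm r)\<^sup>2 - 2 * t * (r \<bullet> w) + t\<^sup>2 * (w \<bullet> w)"
    unfolding power2_norm_eq_inner
    by (simp add: inner_diff_left inner_diff_right inner_commute power2_eq_square algebra_simps)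
  also have "\<dots> = (norm r)\<^sup>2 - (r \<bullet> w)\<^sup>2 / (w \<bullet> w)"
    unfolding t_def using nz by (simp add: power2_eq_square)
  finally have "(r \<bullet> w)\<^sup>2 / (w \<bullet> w) \<le> 0" by simp
  moreover have "0 < (r \<bullet> w)\<^sup>2 / (w \<bullet> w)" using nz inner_ge_zero[of w] by (simp add: less_le)
  ultimately show False by simp
qed

text \<open>Shifting \<open>a\<close> by the fixed point \<open>g\<close> of the map a -> \<delta> a
  + \<eta> cancels the constant terms in the difference of squares and leaves a cross term of
  favourable sign.\<close>

lemma quadratic_recursion_le:
  fixes a b \<eta> \<delta> :: real
  assumes "0 \<le> b" "0 \<le> \<eta>" "0 \<le> \<delta>" "\<delta> < 1" and le: "a\<^sup>2 - b\<^sup>2 \<le> (\<delta> * a + \<eta>)\<^sup>2"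
  shows "a \<le> b / sqrt (1 - \<delta>\<^sup>2) + \<eta> / (1 - \<delta>)"
proof -
  define g where "g = \<eta> / (1 - \<delta>)"
  define d where "d = a - g"
  have g: "\<eta> = (1 - \<delta>) * g" "0 \<le> g" unfolding g_def using assms by simp_all
  have r: "0 < 1 - \<delta>\<^sup>2" using assms by (simp add: abs_square_less_1)
  have "d \<le> b / sqrt (1 - \<delta>\<^sup>2)"
  proof (cases "0 \<le> d")
    case True
    have "a\<^sup>2 - (\<delta> * a + \<eta>)\<^sup>2 = (1 - \<delta>\<^sup>2) * d\<^sup>2 + 2 * (1 - \<delta>) * (d * g)"
      unfolding g(1) d_def by (simp add: power2_eq_square algebra_simps)
    moreover have "0 \<le> 2 * (1 - \<delta>) * (d * g)" using True g assms by simp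
    ultimately have "(1 - \<delta>\<^sup>2) * d\<^sup>2 \<le> b\<^sup>2" using le by linarith
    then have "(sqrt (1 - \<delta>\<^sup>2) * d)\<^sup>2 \<le> b\<^sup>2" using r by (simp add: power_mult_distrib)
    then have "sqrt (1 - \<delta>\<^sup>2) * d \<le> b" using assms(1) by (rule power2_le_imp_le)
    then show ?thesis using r by (simp add: field_simps)
  next
    case False
    have "0 \<le> b / sqrt (1 - \<delta>\<^sup>2)" using assms r by simp
    then show ?thesis using False by linarith
  qed
  then show ?thesis unfolding d_def g_def by simp
qed

text \<open>Testing the orthogonality relation with the part \<open>z\<close> of the error on
  \<open>W\<close> bounds \<open>z\<close> by the whole error and the noise. Off \<open>W\<close>
  the error is just that part of \<open>- h\<close>, and Pythagoras gives the quadratic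
  recursion.\<close>

lemma pursuit_error_le:
  assumes min: "is_arg_min (\<lambda>z. (norm (A *v h + e - A *v z))\<^sup>2) (\<lambda>z. supp z \<subseteq> W) x"
    and W: "card W \<le> k" and h: "card (supp h) \<le> k" and ric: "ric A (2 * k) < 1"
  shows "norm (x - h) \<le> norm (restrict_vec (- W) h) / sqrt (1 - (ric A (2 * k))\<^sup>2)
    + sqrt (1 + ric A k) / (1 - ric A (2 * k)) * norm e"
proof -
  define \<delta> where "\<delta> = ric A (2 * k)"
  define d where "d = x - h"
  define z where "z = restrict_vec W d"
  define \<eta> where "\<eta> = sqrt (1 + ric A k) * norm e"
  have \<delta>: "0 \<le> \<delta>" unfolding \<delta>_def by (rule ric_is_least)
  have \<eta>: "0 \<le> \<eta>" unfolding \<eta>_def using ric_is_least(1)[of A k] by simp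
  have suppx: "supp x \<subseteq> W" using min unfolding is_arg_min_def by blast
  have suppz: "supp z \<subseteq> W" unfolding z_def supp_restrict_vec by auto
  have "(A *v h + e - A *v x) \<bullet> (A *v z) = 0" by (rule arg_min_residual_orthogonal[OF min suppz])
  moreover have "A *v h + e - A *v x = e - A *v d"
    unfolding d_def by (simp add: matrix_vector_mult_diff_distrib)
  ultimately have orth: "(A *v d) \<bullet> (A *v z) = e \<bullet> (A *v z)" by (simp add: inner_diff_left)
  have "supp d \<union> supp z \<subseteq> W \<union> supp h"
    using suppx suppz unfolding d_def supp_def by auto
  then have "card (supp d \<union> supp z) \<le> card (W \<union> supp h)" by (intro card_mono) auto
  also have "\<dots> \<le> 2 * k" using card_Un_le[of W "supp h"] W h by linarith
  finally have "d \<bullet> z - (A *v d) \<bullet> (A *v z) \<le> \<delta> * norm d * norm z"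
    using RIP_inner_le[OF ric_is_least(2)] unfolding \<delta>_def by (meson abs_le_D1)
  moreover have "e \<bullet> (A *v z) \<le> \<eta> * norm z"
  proof -
    have "q_sparse k z"
      unfolding q_sparse_def using card_mono[OF _ suppz] W by (meson finite order_trans)
    then have "(norm (A *v z))\<^sup>2 \<le> (1 + ric A k) * (norm z)\<^sup>2"
      using ric_is_least(2)[of A k] unfolding RIP_def by blast
    then have "norm (A *v z) \<le> sqrt ((1 + ric A k) * (norm z)\<^sup>2)" by (rule real_le_rsqrt)
    then have "norm (A *v z) \<le> sqrt (1 + ric A k) * norm z" by (simp add: real_sqrt_mult)
    then have "norm e * norm (A *v z) \<le> norm e * (sqrt (1 + ric A k) * norm z)"
      by (rule mult_left_mono) simp
    then show ?thesis using norm_cauchy_schwarz[of e "A *v z"] unfolding \<eta>_def by (simp add: mult_ac)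
  qed
  moreover have "d \<bullet> z = (norm z)\<^sup>2" unfolding z_def by (rule inner_restrict_vec)
  ultimately have "norm z * norm z \<le> (\<delta> * norm d + \<eta>) * norm z"
    using orth by (simp add: power2_eq_square algebra_simps)
  then have z: "norm z \<le> \<delta> * norm d + \<eta>"
    using \<delta> \<eta> by (cases "z = 0") auto
  have "(norm d)\<^sup>2 = (norm z)\<^sup>2 + (norm (restrict_vec (- W) d))\<^sup>2"
  proof -
    have "restrict_vec UNIV d = d" unfolding restrict_vec_def by (simp add: vec_eq_iff)
    then show ?thesis
      using norm_restrict_vec[of UNIV d] sum.union_disjoint[of W "- W" "\<lambda>i. (d $ i)\<^sup>2"]
      unfolding z_def norm_restrict_vec[of W] norm_restrict_vec[of "- W"] by simp
  qed
  moreover have "restrict_vec (- W) d = - restrict_vec (- W) h"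
    using suppx unfolding restrict_vec_def d_def supp_def by (auto simp: vec_eq_iff)
  moreover have "(norm z)\<^sup>2 \<le> (\<delta> * norm d + \<eta>)\<^sup>2" by (rule power_mono[OF z]) simp
  ultimately have "(norm d)\<^sup>2 - (norm (restrict_vec (- W) h))\<^sup>2 \<le> (\<delta> * norm d + \<eta>)\<^sup>2" by simp
  then have "norm d \<le> norm (restrict_vec (- W) h) / sqrt (1 - \<delta>\<^sup>2) + \<eta> / (1 - \<delta>)"
    using \<eta> \<delta> ric unfolding \<delta>_def[symmetric] by (intro quadratic_recursion_le) auto
  then show ?thesis unfolding d_def \<delta>_def \<eta>_def by simp
qed

section \<open>Convergence\<close>

text \<open>Restricted isometry controls I - A^T A only between sparse vectors, so the error is
  paired with its own restriction \<open>t\<close>, which recovers \<open>norm t\<close> squared.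
  The remainder \<open>C\<close> and the noise \<open>b\<close> need only operator norms.\<close>

lemma newton_step_error_le:
  fixes A :: "real ^ 'n ^ 'm"
  assumes eps: "0 < \<epsilon>" "(sigma_max A)\<^sup>2 \<le> \<epsilon>" and lam: "0 \<le> lam" "lam \<le> \<epsilon> + (sigma_min A)\<^sup>2"
    and card: "card (supp x \<union> supp h \<union> T) \<le> q"
  shows "norm (restrict_vec T (newton_step A (A *v h + e) \<epsilon> lam x - h))
    \<le> (ric A q + (sigma_max A)\<^sup>2 - lam * (sigma_max A)\<^sup>2 / (\<epsilon> + (sigma_max A)\<^sup>2)) * norm (x - h)
      + lam * sigma_max A / (\<epsilon> + (sigma_max A)\<^sup>2) * norm e"
proof -
  define s where "s = (sigma_max A)\<^sup>2"
  define c where "c = s - lam * s / (\<epsilon> + s)"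
  define v where "v = x - h"
  define M where "M = transpose A *v (A *v v)"
  define C where "C = M - lam *\<^sub>R (normal_inv A \<epsilon> *v M)"
  define b where "b = normal_inv A \<epsilon> *v (transpose A *v e)"
  define r where "r = newton_step A (A *v h + e) \<epsilon> lam x - h"
  define t where "t = restrict_vec T r"
  have "A *v h + e - A *v x = e - A *v v"
    unfolding v_def by (simp add: matrix_vector_mult_diff_distrib)
  then have r: "r = (v - M) + C + lam *\<^sub>R b"
    unfolding r_def newton_step_def C_def b_def M_def v_def
    by (simp add: matrix_vector_mult_diff_distrib algebra_simps)
  have C: "norm C \<le> c * norm v"
    unfolding C_def M_def c_def s_def by (rule newton_remainder_norm_le[OF eps(1) lam(2)])
  have b: "norm b \<le> sigma_max A / (\<epsilon> + s) * norm e"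
    unfolding b_def s_def by (rule normal_inv_transpose_norm_le[OF eps])
  have "supp v \<union> supp t \<subseteq> supp x \<union> supp h \<union> T"
    unfolding t_def supp_restrict_vec v_def by (auto simp: supp_def)
  then have "card (supp v \<union> supp t) \<le> card (supp x \<union> supp h \<union> T)" by (intro card_mono) auto
  with card have "card (supp v \<union> supp t) \<le> q" by linarith
  then have "v \<bullet> t - (A *v v) \<bullet> (A *v t) \<le> ric A q * norm v * norm t"
    using RIP_inner_le[OF ric_is_least(2)] by (meson abs_le_D1)
  then have 1: "(v - M) \<bullet> t \<le> ric A q * norm v * norm t"
    unfolding M_def by (simp add: inner_diff_left inner_matrix_vector_transpose)
  have 2: "C \<bullet> t \<le> c * norm v * norm t"
    using norm_cauchy_schwarz[of C t] mult_right_mono[OF C norm_ge_zero[of t]] by linarith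
  have "b \<bullet> t \<le> sigma_max A / (\<epsilon> + s) * norm e * norm t"
    using norm_cauchy_schwarz[of b t] mult_right_mono[OF b norm_ge_zero[of t]] by linarith
  from mult_left_mono[OF this lam(1)]
  have 3: "lam * (b \<bullet> t) \<le> lam * sigma_max A / (\<epsilon> + s) * norm e * norm t" by simp
  have "norm t * norm t = r \<bullet> t" unfolding t_def inner_restrict_vec by (simp add: power2_eq_square)
  also have "\<dots> = (v - M) \<bullet> t + C \<bullet> t + lam * (b \<bullet> t)" unfolding r by (simp add: inner_add_left)
  also have "\<dots> \<le> ((ric A q + c) * norm v + lam * sigma_max A / (\<epsilon> + s) * norm e) * norm t"
    using 1 2 3 by (simp add: algebra_simps)
  finally have le: "norm t * norm t \<le> ((ric A q + c) * norm v + lam * sigma_max A / (\<epsilon> + s) * norm e) * norm t" .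
  have "0 \<le> ric A q * norm v" using ric_is_least(1)[of A q] by simp
  moreover have "0 \<le> c * norm v" using C norm_ge_zero[of C] by linarith
  moreover have "0 \<le> lam * sigma_max A / (\<epsilon> + s) * norm e"
    using mult_left_mono[OF order_trans[OF norm_ge_zero b] lam(1)] by simp
  ultimately have "norm t \<le> (ric A q + c) * norm v + lam * sigma_max A / (\<epsilon> + s) * norm e"
    using mult_right_le_imp_le[OF le] by (cases "t = 0") (simp_all add: distrib_right)
  then show ?thesis unfolding t_def r_def c_def v_def s_def by (simp add: add_diff_eq)
qed

lemma affine_recursion_le:
  fixes a :: "nat \<Rightarrow> real"
  assumes step: "\<And>p. a (Suc p) \<le> \<rho> * a p + b" and "0 \<le> \<rho>" "\<rho> < 1" "0 \<le> b"
  shows "a p \<le> \<rho> ^ p * a 0 + b / (1 - \<rho>)"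
proof (induction p)
  case 0
  show ?case using assms by simp
next
  case (Suc p)
  have "a (Suc p) \<le> \<rho> * (\<rho> ^ p * a 0 + b / (1 - \<rho>)) + b"
    using step[of p] mult_left_mono[OF Suc \<open>0 \<le> \<rho>\<close>] by linarith
  also have "\<dots> = \<rho> ^ Suc p * a 0 + b / (1 - \<rho>)" using assms by (simp add: field_simps)
  finally show ?case .
qed

theorem mainTheorem3:
  fixes A :: "real ^ 'n ^ 'm"
    and x h :: "real ^ 'n" and e y :: "real ^ 'm"
    and k :: nat and \<epsilon> lam \<sigma>1 \<sigma>m \<rho> \<tau> :: real
    and S :: "'n set" and xs :: "nat \<Rightarrow> real ^ 'n"
  assumes "CARD('m) < CARD('n)"
    and "k \<ge> 1"
    and "\<sigma>1 = sigma_max A" and "\<sigma>m = sigma_min A"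
    and "ric A (3 * k) < 1 / 2"
    and "y = A *v x + e"
    and "h \<in> hard_thresholds k x" and "S = supp h"
    and "\<epsilon> > max (\<sigma>1\<^sup>2) (((\<sigma>1\<^sup>2 - \<sigma>m\<^sup>2) / (1 / 2 - ric A (3 * k)) - 1) * \<sigma>1\<^sup>2)"
    and "\<epsilon> + \<sigma>1\<^sup>2 - (1 / 2 - ric A (3 * k)) * ((\<epsilon> + \<sigma>1\<^sup>2) / \<sigma>1\<^sup>2) < lam"
    and "lam \<le> \<epsilon> + \<sigma>m\<^sup>2"
    and "q_sparse k (xs 0)"
    and "nshtp_sequence A y k \<epsilon> lam xs"
    and "\<rho> = sqrt 3 * (ric A (3 * k) + \<sigma>1\<^sup>2 - lam * \<sigma>1\<^sup>2 / (\<epsilon> + \<sigma>1\<^sup>2))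
               / sqrt (1 - (ric A (2 * k))\<^sup>2)"
    and "\<tau> = 1 / (1 - \<rho>) *
               (sqrt 3 * lam * \<sigma>1 / (sqrt (1 - (ric A (2 * k))\<^sup>2) * (\<epsilon> + \<sigma>1\<^sup>2))
                + sqrt (1 + ric A k) / (1 - ric A (2 * k)))"
  shows "\<rho> < 1 \<and>
    (\<forall>p. norm (xs (Suc p) - restrict_vec S x)
       \<le> \<rho> ^ p * norm (xs 0 - restrict_vec S x)
          + \<tau> * norm (A *v (x - restrict_vec S x) + e))"
proof -
  define s where "s = \<sigma>1\<^sup>2"
  define \<delta> where "\<delta> = ric A (3 * k)"
  define D where "D = sqrt (1 - (ric A (2 * k))\<^sup>2)"
  define \<kappa> where "\<kappa> = \<delta> + s - lam * s / (\<epsilon> + s)"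
  define \<theta> where "\<theta> = lam * \<sigma>1 / (\<epsilon> + s)"
  define \<omega> where "\<omega> = sqrt (1 + ric A k) / (1 - ric A (2 * k))"
  define e' where "e' = A *v (x - restrict_vec S x) + e"
  have \<sigma>1: "0 \<le> \<sigma>1"
    unfolding assms(3) using sigma_min_nonneg[of A] sigma_min_le_sigma_max[of A] by linarith
  have \<delta>: "0 \<le> \<delta>" "\<delta> < 1 / 2" unfolding \<delta>_def using assms(5) ric_is_least(1)[of A "3 * k"] by simp_all
  have \<delta>2: "0 \<le> ric A (2 * k)" "ric A (2 * k) < 1 / 2"
    using ric_is_least(1)[of A "2 * k"] ric_mono[of "2 * k" "3 * k" A] \<delta> unfolding \<delta>_def by simp_all
  have s: "1 / 2 < s"
    using sigma_max_ge_ric[of "3 * k" A] assms(2) \<delta> unfolding s_def assms(3) \<delta>_def by simp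
  have eps: "s < \<epsilon>" "0 < \<epsilon>" using assms(9) s unfolding s_def by auto
  have es: "0 < \<epsilon> + s" using eps s by simp
  have lam_lower: "(\<epsilon> + s) * (1 - (1 / 2 - \<delta>) / s) < lam"
    using assms(10) unfolding s_def[symmetric] \<delta>_def[symmetric] right_diff_distrib
    by (simp add: mult.commute)
  have "(1 / 2 - \<delta>) / s < 1" using s \<delta> by simp
  then have "0 < (\<epsilon> + s) * (1 - (1 / 2 - \<delta>) / s)" using es by simp
  then have lam0: "0 < lam" using lam_lower by linarith
  have "\<sigma>m\<^sup>2 \<le> s"
    unfolding s_def assms(3,4) using sigma_min_le_sigma_max sigma_min_nonneg by (rule power_mono)
  then have "lam \<le> \<epsilon> + s" using assms(11) by linarith
  then have "lam * s \<le> (\<epsilon> + s) * s" using s by (intro mult_right_mono) auto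
  then have "lam * s / (\<epsilon> + s) \<le> s" using es by (simp add: field_simps)
  then have \<kappa>0: "0 \<le> \<kappa>" unfolding \<kappa>_def using \<delta> by linarith
  \<comment> \<open>The lower bound on \<open>lam\<close> is the condition
    \<open>\<kappa> < 1 / 2\<close> solved for \<open>lam\<close>.\<close>
  have "s - (1 / 2 - \<delta>) = s * ((\<epsilon> + s) * (1 - (1 / 2 - \<delta>) / s)) / (\<epsilon> + s)"
  proof -
    have "s * ((\<epsilon> + s) * (1 - (1 / 2 - \<delta>) / s)) / (\<epsilon> + s) = s * (1 - (1 / 2 - \<delta>) / s)"
      using es by simp
    also have "\<dots> = s - s * ((1 / 2 - \<delta>) / s)" unfolding right_diff_distrib by simp
    also have "s * ((1 / 2 - \<delta>) / s) = 1 / 2 - \<delta>" using s by simp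
    finally show ?thesis by simp
  qed
  also have "\<dots> < s * lam / (\<epsilon> + s)"
    using es s lam_lower by (intro divide_strict_right_mono mult_strict_left_mono) auto
  finally have \<kappa>: "\<kappa> < 1 / 2" unfolding \<kappa>_def by (simp add: mult.commute)
  \<comment> \<open>A constant below 1/2 gives \<open>D > sqrt 3 / 2\<close>, just enough for
    \<open>\<kappa> < 1 / 2\<close> to yield \<open>\<rho> < 1\<close>.\<close>
  have "(ric A (2 * k))\<^sup>2 < (1 / 2)\<^sup>2" using \<delta>2 by (intro power_strict_mono) auto
  then have "sqrt (3 / 4) < D" unfolding D_def by (intro real_sqrt_less_mono) (simp add: power2_eq_square)
  then have D: "sqrt 3 / 2 < D" by (simp add: real_sqrt_divide)
  then have D0: "0 < D" by (meson divide_nonneg_nonneg le_less_trans real_sqrt_ge_zero zero_le_numeral)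
  have \<rho>: "\<rho> = sqrt 3 * \<kappa> / D"
    unfolding assms(14) \<kappa>_def D_def \<delta>_def s_def ..
  have "sqrt 3 * \<kappa> < sqrt 3 * (1 / 2)" using \<kappa> by (intro mult_strict_left_mono) auto
  then have "sqrt 3 * \<kappa> < D" using D by linarith
  then have \<rho>1: "\<rho> < 1" unfolding \<rho> using D0 by simp
  have \<rho>0: "0 \<le> \<rho>" unfolding \<rho> using \<kappa>0 D0 by simp
  define \<beta> where "\<beta> = sqrt 3 * \<theta> / D + \<omega>"
  have \<theta>0: "0 \<le> \<theta>" unfolding \<theta>_def using lam0 \<sigma>1 es by simp
  have \<omega>0: "0 \<le> \<omega>" unfolding \<omega>_def using \<delta>2 ric_is_least(1)[of A k] by simp
  have \<beta>0: "0 \<le> \<beta>" unfolding \<beta>_def using \<theta>0 \<omega>0 D0 by simp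
  have \<tau>: "\<tau> = \<beta> / (1 - \<rho>)"
    unfolding assms(15) \<beta>_def \<theta>_def \<omega>_def D_def s_def by (simp add: mult_ac)
  have hS: "restrict_vec S x = h"
    using assms(7) unfolding assms(8) hard_thresholds_def
    by (auto simp: supp_def restrict_vec_def vec_eq_iff)
  have y: "y = A *v h + e'"
    unfolding assms(6) e'_def hS by (simp add: matrix_vector_mult_diff_distrib)
  have h: "card (supp h) \<le> k" by (rule card_supp_hard_thresholds[OF assms(7)])
  obtain xbar where ht: "\<And>p. xbar p \<in> hard_thresholds k (newton_step A y \<epsilon> lam (xs p))"
    and min: "\<And>p. is_arg_min (\<lambda>z. (norm (y - A *v z))\<^sup>2) (\<lambda>z. supp z \<subseteq> supp (xbar p)) (xs (Suc p))"
    using assms(13) unfolding nshtp_sequence_def by metis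
  have W: "card (supp (xbar p)) \<le> k" for p by (rule card_supp_hard_thresholds[OF ht])
  \<comment> \<open>The start is sparse by hypothesis; later iterates inherit it from the
    thresholded support.\<close>
  have sparse: "card (supp (xs p)) \<le> k" for p
  proof (cases p)
    case 0
    then show ?thesis using assms(12) unfolding q_sparse_def by simp
  next
    case (Suc r)
    have "supp (xs (Suc r)) \<subseteq> supp (xbar r)" using min[of r] unfolding is_arg_min_def by blast
    then have "card (supp (xs (Suc r))) \<le> card (supp (xbar r))" by (intro card_mono) auto
    then show ?thesis using W[of r] Suc by simp
  qed
  have step: "norm (xs (Suc p) - h) \<le> \<rho> * norm (xs p - h) + \<beta> * norm e'" for p
  proof -
    define u where "u = newton_step A y \<epsilon> lam (xs p)"
    define T where "T = supp h \<union> supp (xbar p)"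
    \<comment> \<open>Three supports of size at most \<open>k\<close> meet here, hence the order
      \<open>3 * k\<close>.\<close>
    have "card (supp (xs p) \<union> supp h \<union> T) \<le> card (supp (xs p)) + card (supp h) + card (supp (xbar p))"
      unfolding T_def using card_Un_le[of "supp (xs p) \<union> supp h" "supp (xbar p)"]
        card_Un_le[of "supp (xs p)" "supp h"] by (simp add: Un_ac)
    also have "\<dots> \<le> 3 * k" using sparse[of p] h W[of p] by linarith
    finally have card: "card (supp (xs p) \<union> supp h \<union> T) \<le> 3 * k" .
    have t: "norm (restrict_vec T (u - h)) \<le> \<kappa> * norm (xs p - h) + \<theta> * norm e'"
      using newton_step_error_le[OF eps(2) _ _ _ card, where lam = lam and e = e'] eps(1) lam0 assms(11)
      unfolding u_def y \<kappa>_def \<theta>_def \<delta>_def s_def assms(3,4) by simp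
    have "norm (restrict_vec (- supp (xbar p)) h) \<le> sqrt 2 * norm (restrict_vec T (u - h))"
      unfolding T_def u_def by (rule norm_outside_hard_thresholds_le[OF ht h])
    \<comment> \<open>The thresholding factor \<open>sqrt 2\<close> is relaxed to the constant in
      \<open>\<rho>\<close>.\<close>
    also have "\<dots> \<le> sqrt 3 * (\<kappa> * norm (xs p - h) + \<theta> * norm e')"
      by (intro mult_mono t) auto
    finally have "norm (restrict_vec (- supp (xbar p)) h) / D
        \<le> sqrt 3 * (\<kappa> * norm (xs p - h) + \<theta> * norm e') / D"
      using D0 by (intro divide_right_mono) auto
    moreover have "norm (xs (Suc p) - h) \<le> norm (restrict_vec (- supp (xbar p)) h) / D + \<omega> * norm e'"
      unfolding D_def \<omega>_def
      by (rule pursuit_error_le[OF min[of p, unfolded y] W h]) (use \<delta>2 in simp)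
    ultimately have "norm (xs (Suc p) - h)
        \<le> sqrt 3 * (\<kappa> * norm (xs p - h) + \<theta> * norm e') / D + \<omega> * norm e'" by linarith
    also have "\<dots> = \<rho> * norm (xs p - h) + \<beta> * norm e'"
      unfolding \<rho> \<beta>_def using D0 by (simp add: field_simps)
    finally show ?thesis .
  qed
  have "norm (xs (Suc p) - h) \<le> \<rho> ^ p * norm (xs 0 - h) + \<tau> * norm e'" for p
  proof -
    have "norm (xs (Suc p) - h) \<le> \<rho> ^ Suc p * norm (xs 0 - h) + \<beta> * norm e' / (1 - \<rho>)"
      by (rule affine_recursion_le[where a = "\<lambda>p. norm (xs p - h)"])
        (use step \<rho>0 \<rho>1 \<beta>0 in auto)
    \<comment> \<open>The recursion yields one more power of \<open>\<rho>\<close> than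
      claimed.\<close>
    moreover have "\<rho> ^ Suc p * norm (xs 0 - h) \<le> \<rho> ^ p * norm (xs 0 - h)"
      using \<rho>0 \<rho>1 by (intro mult_right_mono power_decreasing) auto
    ultimately show ?thesis unfolding \<tau> by simp
  qed
  then show ?thesis using \<rho>1 unfolding hS e'_def by simp
qed

end
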